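(* Let $\beta,\gamma\in(0,1)$, let the supply and demand assumptions in the context hold, and let $p_L<p_H\le p_{\rm bal}$. Then in the throughput game $(H,H)$ is always a Nash equilibrium and $(L,L)$ is never a Nash equilibrium. Moreover (first entry: Platform 1's price, second entry: Platform 2's price): 1. $(L,H)$ is a Nash equilibrium iff $0<\beta\le\min\left\{1,\dfrac{w(\gamma p_L)}{w(\gamma p_H)}\right\}$. 2. $(H,L)$ is a Nash equilibrium iff $\max\left\{1-\dfrac{w(\gamma p_L)}{w(\gamma p_H)},0\right\}\le\beta<1$.
   Context: Supply and demand assumptions. $w(p)>0$ (supply) and $c(p)>0$ (demand) are real-valued functions of the price $p>0$; $c$ is strictly decreasing, $w$ is strictly increasing; $0<p_L<p_H$; there is a unique price $p_{\rm bal}$ with $w(\gamma p_{\rm bal})=c(p_{\rm bal})$. Throughput game. Two platforms simultaneously choose a strategy in $\{L,H\}$, i.e. a price $p_1$ (Platform 1), $p_2$ (Platform 2) in $\{p_L,p_H\}$. Given $(p_1,p_2)$, the throughput of Platform 1 is $$N_1(p_1,p_2)=\min\Big\{w(\gamma p_1),\tfrac{\beta}{1-\beta}w(\gamma p_2),c(p_1),\tfrac{\beta}{1-\beta}c(p_2),\beta c(\min\{p_1,p_2\}),\beta w(\max\{\gamma p_1,\gamma p_2\})\Big\}$$ and the throughput of Platform 2 is $N_2(p_1,p_2)=\frac{1-\beta}{\beta}N_1(p_1,p_2)$. (These are the numbers of matched worker–customer pairs at the two platforms in the aggregate-utility-maximizing allocation of users under customer loyalty $\beta$.) The payoff of Platform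 $i$ is its throughput $N_i$. A pair of strategies is a (pure strategy) Nash equilibrium if no platform can strictly increase its payoff by a unilateral change of strategy. *)

theory Defs
  imports Complex_Main
begin

definition nash_equilibrium ::
  "'s set \<Rightarrow> ('s \<Rightarrow> 's \<Rightarrow> real) \<Rightarrow> ('s \<Rightarrow> 's \<Rightarrow> real) \<Rightarrow> 's \<times> 's \<Rightarrow> bool" where
  "nash_equilibrium S u1 u2 = (\<lambda>(s1, s2).
     s1 \<in> S \<and> s2 \<in> S \<and>
     \<not> (\<exists>t\<in>S. u1 t s2 > u1 s1 s2) \<and>
     \<not> (\<exists>t\<in>S. u2 s1 t > u2 s1 s2))"

(* N1 and N2 are the numbers of matched worker-customer pairs at the two platforms in the
   aggregate-utility-maximizing allocation: w is supply, c is demand, \<beta> is customer loyalty, and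
   at price p the supply is w (\<gamma> * p) while the demand is c p. *)

definition N1 ::
  "(real \<Rightarrow> real) \<Rightarrow> (real \<Rightarrow> real) \<Rightarrow> real \<Rightarrow> real \<Rightarrow> real \<Rightarrow> real \<Rightarrow> real" where
  "N1 w c \<beta> \<gamma> p1 p2 =
     Min {w (\<gamma> * p1), \<beta> / (1 - \<beta>) * w (\<gamma> * p2),
          c p1, \<beta> / (1 - \<beta>) * c p2,
          \<beta> * c (min p1 p2), \<beta> * w (max (\<gamma> * p1) (\<gamma> * p2))}"

definition N2 ::
  "(real \<Rightarrow> real) \<Rightarrow> (real \<Rightarrow> real) \<Rightarrow> real \<Rightarrow> real \<Rightarrow> real \<Rightarrow> real \<Rightarrow> real" where
  "N2 w c \<beta> \<gamma> p1 p2 = (1 - \<beta>) / \<beta> * N1 w c \<beta> \<gamma> p1 p2"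

(* A strategy is identified with the price it stands for, which loses nothing since pL < pH. *)

definition throughput_NE ::
  "(real \<Rightarrow> real) \<Rightarrow> (real \<Rightarrow> real) \<Rightarrow> real \<Rightarrow> real \<Rightarrow> real \<Rightarrow> real \<Rightarrow> real \<times> real \<Rightarrow> bool" where
  "throughput_NE w c \<beta> \<gamma> pL pH =
     nash_equilibrium {pL, pH} (N1 w c \<beta> \<gamma>) (N2 w c \<beta> \<gamma>)"

end

theory Submission
  imports Defs
begin

text \<open>
  At any two prices up to the balance price, demand at either price is at least the supply at the
  other, since the common value at balance separates them. Hence the demand terms of the throughput
  never bind: with $a = w(\gamma p_L) < b = w(\gamma p_H)$ the throughput of Platform 1 is
  determined by the supply at the two prices alone (lemma \<open>N1_eq_supply\<close>), namely
  \<^item> $\beta b$ at $(H,H)$ and $\beta a$ at $(L,L)$,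
  \<^item> $\min\{a, \beta b\}$ at $(L,H)$,
  \<^item> $\min\{\beta a/(1-\beta), \beta b\}$ at $(H,L)$.

  The throughput of Platform 2 is a fixed positive multiple of the throughput of Platform 1, so both
  platforms rank the four outcomes alike, and an equilibrium is an outcome that is not improved by
  changing one coordinate. No value exceeds $\beta b$, and $\beta a$ is strictly smaller than the
  other three; this settles the two symmetric outcomes and shows that no deviation from a mixed
  outcome to $(L,L)$ pays off. A mixed outcome is thus an equilibrium exactly when it already
  attains the value $\beta b$ of $(H,H)$:
  this means $\beta b \le a$ for $(L,H)$ and $(1-\beta) b \le a$ for $(H,L)$.
\<close>

text \<open>
  Each supply term of the throughput lies below the demand term with the same factor, because supply
  is at most, and demand at least, the common value at $p_{bal}$.
\<close>
lemma N1_eq_supply: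
  fixes w c :: "real \<Rightarrow> real"
  assumes \<beta>: "0 < \<beta>" "\<beta> < 1" and \<gamma>: "0 < \<gamma>"
    and w: "mono_on {0<..} w" and c: "antimono_on {0<..} c"
    and bal: "w (\<gamma> * pbal) = c pbal"
    and p: "0 < p" "p \<le> pbal" and q: "0 < q" "q \<le> pbal"
  shows "N1 w c \<beta> \<gamma> p q =
    min (min (w (\<gamma> * p)) (\<beta> / (1 - \<beta>) * w (\<gamma> * q))) (\<beta> * w (\<gamma> * max p q))"
proof -
  have supply_le_demand: "w (\<gamma> * r) \<le> c s"
    if "0 < r" "r \<le> pbal" "0 < s" "s \<le> pbal" for r s
  proof -
    have "w (\<gamma> * r) \<le> w (\<gamma> * pbal)"
      using that \<gamma> by (intro mono_onD[OF w]) auto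
    also have "\<dots> \<le> c s"
      using that monotone_onD[OF c, of s pbal] bal by simp
    finally show ?thesis .
  qed
  have "w (\<gamma> * p) \<le> c p"
    using p by (rule supply_le_demand) (use p in auto)
  moreover have "\<beta> / (1 - \<beta>) * w (\<gamma> * q) \<le> \<beta> / (1 - \<beta>) * c q"
    using supply_le_demand[OF q q] \<beta> by (intro mult_left_mono) auto
  moreover have "\<beta> * w (\<gamma> * max p q) \<le> \<beta> * c (min p q)"
    using p q \<beta> by (intro mult_left_mono supply_le_demand) auto
  moreover have "max (\<gamma> * p) (\<gamma> * q) = \<gamma> * max p q"
    using \<gamma> by (simp add: max_mult_distrib_left)
  ultimately show ?thesis
    by (simp add: N1_def min_def)
qed

lemma nash_equilibrium_pair:
  "nash_equilibrium {s, t} u v (x, y) \<longleftrightarrow>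
    x \<in> {s, t} \<and> y \<in> {s, t} \<and> u s y \<le> u x y \<and> u t y \<le> u x y \<and> v x s \<le> v x y \<and> v x t \<le> v x y"
  by (auto simp: nash_equilibrium_def not_less)

text \<open>Both platforms rank price profiles in the same way, so all comparisons reduce to $N_1$.\<close>
lemma N2_le_iff:
  assumes "0 < \<beta>" "\<beta> < 1"
  shows "N2 w c \<beta> \<gamma> p q \<le> N2 w c \<beta> \<gamma> p' q' \<longleftrightarrow> N1 w c \<beta> \<gamma> p q \<le> N1 w c \<beta> \<gamma> p' q'"
  unfolding N2_def using assms by (intro mult_le_cancel_left_pos) simp

theorem theorem3:
  fixes w c :: "real \<Rightarrow> real" and \<beta> \<gamma> pL pH pbal :: real
  assumes "0 < \<beta>" "\<beta> < 1" and "0 < \<gamma>" "\<gamma> < 1"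
    and w_pos: "\<And>p. p > 0 \<Longrightarrow> w p > 0"
    and c_pos: "\<And>p. p > 0 \<Longrightarrow> c p > 0"
    and w_incr: "strict_mono_on {0<..} w"
    and c_decr: "strict_antimono_on {0<..} c"
    and bal: "pbal > 0" "w (\<gamma> * pbal) = c pbal"
    and bal_unique: "\<And>p. p > 0 \<Longrightarrow> w (\<gamma> * p) = c p \<Longrightarrow> p = pbal"
    and prices: "0 < pL" "pL < pH" "pH \<le> pbal"
  shows "throughput_NE w c \<beta> \<gamma> pL pH (pH, pH)
    \<and> \<not> throughput_NE w c \<beta> \<gamma> pL pH (pL, pL)
    \<and> (throughput_NE w c \<beta> \<gamma> pL pH (pL, pH) \<longleftrightarrow>
         0 < \<beta> \<and> \<beta> \<le> min 1 (w (\<gamma> * pL) / w (\<gamma> * pH)))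
    \<and> (throughput_NE w c \<beta> \<gamma> pL pH (pH, pL) \<longleftrightarrow>
         max (1 - w (\<gamma> * pL) / w (\<gamma> * pH)) 0 \<le> \<beta> \<and> \<beta> < 1)"
proof -
  define a b k where "a = w (\<gamma> * pL)" and "b = w (\<gamma> * pH)" and "k = \<beta> / (1 - \<beta>)"
  have pos: "0 < a" "0 < b"
    unfolding a_def b_def using prices \<open>0 < \<gamma>\<close> by (auto intro!: w_pos)
  have ab: "a < b"
    unfolding a_def b_def using prices \<open>0 < \<gamma>\<close> by (intro strict_mono_onD[OF w_incr]) auto
  have w_mono: "mono_on {0<..} w"
    using w_incr by (rule strict_mono_on_imp_mono_on)
  have c_anti: "antimono_on {0<..} c"
    using c_decr by (fastforce simp: monotone_on_def order_le_less)
  have k: "\<beta> < k"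
    using \<open>0 < \<beta>\<close> \<open>\<beta> < 1\<close> by (simp add: k_def field_simps)
  have less: "\<beta> * a < a" "\<beta> * b < b" "\<beta> * a < \<beta> * b" "\<beta> * a < k * a" "\<beta> * b < k * b"
    using pos ab k \<open>0 < \<beta>\<close> \<open>\<beta> < 1\<close> by simp_all
  note N1_eq = N1_eq_supply[OF \<open>0 < \<beta>\<close> \<open>\<beta> < 1\<close> \<open>0 < \<gamma>\<close> w_mono c_anti bal(2)]
  have HH: "N1 w c \<beta> \<gamma> pH pH = \<beta> * b"
    using prices less by (subst N1_eq) (auto simp flip: b_def k_def)
  have LL: "N1 w c \<beta> \<gamma> pL pL = \<beta> * a"
    using prices less by (subst N1_eq) (auto simp flip: a_def k_def)
  have LH: "N1 w c \<beta> \<gamma> pL pH = min a (\<beta> * b)"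
    using prices less by (subst N1_eq) (auto simp: max_def simp flip: a_def b_def k_def)
  have HL: "N1 w c \<beta> \<gamma> pH pL = min (k * a) (\<beta> * b)"
    using prices less by (subst N1_eq) (auto simp: max_def simp flip: a_def b_def k_def)
  note NE = throughput_NE_def nash_equilibrium_pair N2_le_iff[OF \<open>0 < \<beta>\<close> \<open>\<beta> < 1\<close>] HH LL LH HL
  have "throughput_NE w c \<beta> \<gamma> pL pH (pH, pH)"
    by (simp add: NE)
  moreover have "\<not> throughput_NE w c \<beta> \<gamma> pL pH (pL, pL)"
    using less by (simp add: NE)
  moreover have "throughput_NE w c \<beta> \<gamma> pL pH (pL, pH) \<longleftrightarrow> \<beta> \<le> a / b"
    using less pos by (simp add: NE field_simps)
  moreover have "throughput_NE w c \<beta> \<gamma> pL pH (pH, pL) \<longleftrightarrow> 1 - a / b \<le> \<beta>"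
  proof -
    have "throughput_NE w c \<beta> \<gamma> pL pH (pH, pL) \<longleftrightarrow> \<beta> * b \<le> k * a"
      using less by (auto simp: NE)
    also have "\<dots> \<longleftrightarrow> \<beta> * ((1 - \<beta>) * b) \<le> \<beta> * a"
      using \<open>\<beta> < 1\<close> by (simp add: k_def field_simps)
    also have "\<dots> \<longleftrightarrow> (1 - \<beta>) * b \<le> a"
      using \<open>0 < \<beta>\<close> by simp
    also have "\<dots> \<longleftrightarrow> 1 - a / b \<le> \<beta>"
      using pos by (simp add: field_simps)
    finally show ?thesis .
  qed
  ultimately show ?thesis
    using \<open>0 < \<beta>\<close> \<open>\<beta> < 1\<close> unfolding a_def b_def by simp
qed

end
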